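(* Let $G$ be a simple (undirected, unweighted) graph on $n$ nodes with Laplacian $L_n$, maximum degree $\Delta$, and $Z_n:=I_n-\tau L_n$ with $0<\tau<1/\Delta$. Let $k<n$ and, for $S\subset\{1,\dots,n\}$ with $|S|=k$ and sufficiently small $\epsilon>0$, set ${}^S\tilde L_n:=L_n-\epsilon\sum_{j\in S}e_je_j^T$ and ${}^S\tilde Z_n:=Z_n+\epsilon\sum_{j\in S}e_je_j^T$. Then the subsets maximizing the smallest eigenvalue of the perturbed Laplacian coincide with the subsets minimizing the largest eigenvalue of the perturbed stochastic matrix: \[\arg\max_{S:\,|S|=k}\lambda_{\min}({}^S\tilde L_n)=\arg\min_{S:\,|S|=k}\lambda_{\max}({}^S\tilde Z_n).\]
   Context: $e_j$ denotes the $j$-th column of $I_n$. The equality is understood as equality of the sets of optimizing subsets $S$. *)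

theory Defs
  imports "Jordan_Normal_Form.Spectral_Radius" "Graph_Theory.Pair_Digraph"
begin

text \<open>
  A simple undirected graph on \<open>n\<close> nodes is a \<^const>\<open>pair_graph\<close> (finite, loop-free, symmetric arc
  relation, no parallel arcs) with vertex set \<open>{..<n}\<close>; nodes are numbered from \<open>0\<close>, as are the
  indices of \<^typ>\<open>real mat\<close>. Each edge is represented by its two opposite arcs, so the degree of a
  node is its out-degree.
\<close>

definition max_degree :: "nat pair_pre_digraph \<Rightarrow> nat" where
  "max_degree G = Max (out_degree (with_proj G) ` pverts G)"

definition degree_mat :: "nat \<Rightarrow> nat pair_pre_digraph \<Rightarrow> real mat" where
  "degree_mat n G = mat n n (\<lambda>(i, j). if i = j then real (out_degree (with_proj G) i) else 0)"

definition adjacency_mat :: "nat \<Rightarrow> nat pair_pre_digraph \<Rightarrow> real mat" where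
  "adjacency_mat n G = mat n n (\<lambda>(i, j). if (i, j) \<in> parcs G then 1 else 0)"

definition laplacian :: "nat \<Rightarrow> nat pair_pre_digraph \<Rightarrow> real mat" where
  "laplacian n G = degree_mat n G - adjacency_mat n G"

definition stochastic_mat :: "nat \<Rightarrow> nat pair_pre_digraph \<Rightarrow> real \<Rightarrow> real mat" where
  "stochastic_mat n G \<tau> = 1\<^sub>m n - \<tau> \<cdot>\<^sub>m laplacian n G"

text \<open>
  \<open>\<Sum>j\<in>S. e\<^sub>j e\<^sub>j\<^sup>T\<close>, written entrywise because matrices of a variable dimension do not form
  a type-class monoid.
\<close>
definition sum_unit_outer :: "nat \<Rightarrow> nat set \<Rightarrow> real mat" where
  "sum_unit_outer n S = mat n n (\<lambda>(a, b). \<Sum>j\<in>S. unit_vec n j $ a * unit_vec n j $ b)"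

definition perturbed_laplacian ::
    "nat \<Rightarrow> nat pair_pre_digraph \<Rightarrow> real \<Rightarrow> nat set \<Rightarrow> real mat" where
  "perturbed_laplacian n G \<epsilon> S = laplacian n G - \<epsilon> \<cdot>\<^sub>m sum_unit_outer n S"

definition perturbed_stochastic_mat ::
    "nat \<Rightarrow> nat pair_pre_digraph \<Rightarrow> real \<Rightarrow> real \<Rightarrow> nat set \<Rightarrow> real mat" where
  "perturbed_stochastic_mat n G \<tau> \<epsilon> S = stochastic_mat n G \<tau> + \<epsilon> \<cdot>\<^sub>m sum_unit_outer n S"

text \<open>
  Intended for symmetric matrices of positive dimension: their eigenvalues are all real, so
  \<^const>\<open>spectrum\<close>, taken over the reals, is the full spectrum, and it is finite and nonempty.
\<close>

definition lambda_min :: "real mat \<Rightarrow> real" where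
  "lambda_min A = Min (spectrum A)"

definition lambda_max :: "real mat \<Rightarrow> real" where
  "lambda_max A = Max (spectrum A)"

end

theory Submission
  imports Defs "HOL-Analysis.Function_Topology"
begin

text \<open>
  Since \<open>Z + \<epsilon> P\<^sub>S = I - \<tau> (L - (\<epsilon>/\<tau>) P\<^sub>S)\<close> with \<open>P\<^sub>S = \<Sum>j\<in>S. e\<^sub>j e\<^sub>j\<^sup>T\<close>, minimizing
  the largest eigenvalue of the perturbed stochastic matrix at \<open>\<epsilon>\<close> means maximizing
  \<open>f\<^sub>S(\<epsilon>/\<tau>)\<close>, where \<open>f\<^sub>S(\<epsilon>)\<close> is the smallest eigenvalue of \<open>L - \<epsilon> P\<^sub>S\<close>. So the point is that
  the maximizers of \<open>f\<^sub>S(\<epsilon>)\<close> do not depend on \<open>\<epsilon>\<close> near \<open>0\<close>, i.e. that \<open>g = f\<^sub>S - f\<^sub>T\<close> has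
  constant sign to the right of \<open>0\<close>. By the Rayleigh principle \<open>g\<close> is continuous. It is an
  eigenvalue of \<open>(L - \<epsilon> P\<^sub>S) \<otimes> I - I \<otimes> (L - \<epsilon> P\<^sub>T)\<close>, so it satisfies \<open>F(\<epsilon>, g(\<epsilon>)) = 0\<close> for a
  polynomial \<open>F \<noteq> 0\<close>. Write \<open>F = y\<^sup>m Q\<close> with \<open>Q(\<epsilon>, 0) \<noteq> 0\<close> for small \<open>\<epsilon> > 0\<close>. There \<open>g\<close> vanishes
  exactly where \<open>Q(\<epsilon>, g(\<epsilon>)) \<noteq> 0\<close>, so its zero set is open and closed, and
  connectedness makes it everything or nothing.
\<close>

section \<open>Bivariate polynomials and signs of algebraic functions near 0\<close>

text \<open>The outer variable of \<open>P\<close> is \<open>y\<close>, its coefficients are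
  polynomials in \<open>t\<close>, and \<open>poly (poly P [:y:]) t\<close> is the value at
  \<open>(t, y)\<close>. Splitting off the full multiplicity of the root \<open>y = 0\<close> leaves
  a \<open>Q\<close> whose restriction to \<open>y = 0\<close> is a nonzero polynomial in
  \<open>t\<close>.\<close>

lemma poly_poly_power_decomp:
  fixes P :: "real poly poly"
  assumes "P \<noteq> 0"
  shows "\<exists>Q m. poly Q 0 \<noteq> 0 \<and> (\<forall>t y. poly (poly P [:y:]) t = y ^ m * poly (poly Q [:y:]) t)"
proof -
  obtain Q where P: "P = [:- 0, 1:] ^ order 0 P * Q" and Q: "\<not> [:- 0, 1:] dvd Q"
    using order_decomp[OF assms, of 0] by blast
  have "poly (poly P [:y:]) t = y ^ order 0 P * poly (poly Q [:y:]) t" for t y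
    by (subst P) simp
  moreover have "poly Q 0 \<noteq> 0"
    using Q by (simp add: poly_eq_0_iff_dvd)
  ultimately show ?thesis
    by blast
qed

lemma continuous_on_poly_poly:
  fixes P :: "real poly poly" and g :: "real \<Rightarrow> real"
  assumes "continuous_on X g"
  shows "continuous_on X (\<lambda>t. poly (poly P [:g t:]) t)"
  using assms by (induction P) (auto intro!: continuous_intros)

lemma nonzero_poly_no_roots_right_of_0:
  fixes p :: "real poly"
  assumes "p \<noteq> 0"
  obtains d where "d > 0" and "\<And>t. 0 < t \<Longrightarrow> t < d \<Longrightarrow> poly p t \<noteq> 0"
proof -
  define R where "R = {t. poly p t = 0 \<and> t > 0}"
  have fin: "finite R"
    unfolding R_def using poly_roots_finite[OF assms] by simp
  show thesis
  \<comment> \<open>Inserting 1 keeps the minimum meaningful when there are no positive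
    roots.\<close>
  proof (rule that[of "Min (insert 1 R)"])
    show "Min (insert 1 R) > 0"
      using fin by (auto simp: R_def)
    show "poly p t \<noteq> 0" if "0 < t" "t < Min (insert 1 R)" for t
      using that fin by (auto simp: R_def)
  qed
qed

text \<open>Continuity alone would allow oscillation such as \<open>t * sin (1 / t)\<close>; the
  polynomial equation excludes it by making the zero set of \<open>g\<close> clopen near 0.\<close>

lemma algebraic_sgn_eventually_constant:
  fixes g :: "real \<Rightarrow> real" and P :: "real poly poly"
  assumes cont: "continuous_on {0<..} g" and "P \<noteq> 0"
    and root: "\<And>t. t > 0 \<Longrightarrow> poly (poly P [:g t:]) t = 0"
  shows "\<exists>d>0. \<forall>s t. 0 < s \<longrightarrow> s < d \<longrightarrow> 0 < t \<longrightarrow> t < d \<longrightarrow> sgn (g s) = sgn (g t)"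
proof -
  obtain Q m where Q: "poly Q 0 \<noteq> 0"
    and PQ: "\<forall>t y. poly (poly P [:y:]) t = y ^ m * poly (poly Q [:y:]) t"
    using poly_poly_power_decomp[OF \<open>P \<noteq> 0\<close>] by blast
  obtain d where "d > 0" and d: "\<And>t. 0 < t \<Longrightarrow> t < d \<Longrightarrow> poly (poly Q 0) t \<noteq> 0"
    using nonzero_poly_no_roots_right_of_0[OF Q] by metis
  let ?I = "{0<..<d}"
  have contI: "continuous_on ?I g"
    using cont by (rule continuous_on_subset) auto
  have contQ: "continuous_on ?I (\<lambda>t. poly (poly Q [:g t:]) t)"
    by (rule continuous_on_poly_poly[OF contI])
  \<comment> \<open>If \<open>g t = 0\<close>, the second value is that of \<open>Q\<close> at
    \<open>(t, 0)\<close>, nonzero by the choice of \<open>d\<close>. Conversely, if it is nonzero,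
    the root equation forces \<open>g t ^ m = 0\<close>.\<close>
  have zero_iff: "g t = 0 \<longleftrightarrow> poly (poly Q [:g t:]) t \<noteq> 0" if "t \<in> ?I" for t
    using root[of t] PQ[rule_format, of "g t" t] d[of t] that by auto
  have "connected ?I"
    by simp
  have all_or_none: "(\<forall>t\<in>?I. g t = 0) \<or> (\<forall>t\<in>?I. g t \<noteq> 0)"
  proof -
    have "openin (top_of_set ?I) (?I \<inter> g -` (- {0}))"
      by (rule continuous_openin_preimage_gen[OF contI]) auto
    moreover have "openin (top_of_set ?I) (?I \<inter> (\<lambda>t. poly (poly Q [:g t:]) t) -` (- {0}))"
      by (rule continuous_openin_preimage_gen[OF contQ]) auto
    moreover have "?I \<inter> (\<lambda>t. poly (poly Q [:g t:]) t) -` (- {0}) = ?I - (?I \<inter> g -` (- {0}))"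
      using zero_iff by auto
    ultimately have "closedin (top_of_set ?I) (?I \<inter> g -` (- {0}))"
      by (simp add: closedin_def)
    with \<open>openin (top_of_set ?I) (?I \<inter> g -` (- {0}))\<close> \<open>connected ?I\<close>
    have "?I \<inter> g -` (- {0}) = {} \<or> ?I \<inter> g -` (- {0}) = ?I"
      unfolding connected_clopen by blast
    then show ?thesis by auto
  qed
  have "sgn (g s) = sgn (g t)" if "0 < s" "s < d" "0 < t" "t < d" for s t
  proof (rule ccontr)
    assume ne: "sgn (g s) \<noteq> sgn (g t)"
    \<comment> \<open>Were \<open>g\<close> zero on the whole interval, all signs would agree. So
      \<open>g\<close> has no zero there, and unequal signs are opposite, which contradicts the
      intermediate value property.\<close>
    with all_or_none that have nz: "\<forall>t\<in>?I. g t \<noteq> 0"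
      by auto
    have "connected (g ` ?I)"
      using connected_continuous_image[OF contI] by simp
    moreover have "g s \<in> g ` ?I" "g t \<in> g ` ?I"
      using that by auto
    moreover have "g s \<noteq> 0" "g t \<noteq> 0"
      using nz that by auto
    then have "g s < 0 \<and> 0 < g t \<or> g t < 0 \<and> 0 < g s"
      using ne by (auto simp: sgn_if split: if_splits)
    ultimately have "0 \<in> g ` ?I"
      using connectedD_interval[of "g ` ?I" "g s" "g t" 0]
        connectedD_interval[of "g ` ?I" "g t" "g s" 0] by auto
    with nz show False
      by auto
  qed
  with \<open>d > 0\<close> show ?thesis
    by blast
qed

section \<open>Differences of eigenvalues as roots of one polynomial\<close>

text \<open>\<open>A \<otimes> I - I \<otimes> B\<close>, with the pair \<open>(i, j)\<close> encoded as the index \<open>i * n + j\<close>.\<close>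

definition kronecker_diff :: "nat \<Rightarrow> 'a::comm_ring_1 mat \<Rightarrow> 'a mat \<Rightarrow> 'a mat" where
  "kronecker_diff n A B = mat (n * n) (n * n) (\<lambda>(p, q).
     (if p mod n = q mod n then A $$ (p div n, q div n) else 0)
     - (if p div n = q div n then B $$ (p mod n, q mod n) else 0))"

lemma sum_div_mod:
  fixes f :: "nat \<Rightarrow> nat \<Rightarrow> 'a::comm_monoid_add"
  shows "(\<Sum>q<n * n. f (q div n) (q mod n)) = (\<Sum>i<n. \<Sum>j<n. f i j)"
proof -
  have "(\<Sum>q<n * n. f (q div n) (q mod n)) = (\<Sum>(i, j)\<in>{..<n} \<times> {..<n}. f i j)"
  proof (rule sum.reindex_bij_witness[where j = "\<lambda>q. (q div n, q mod n)" and i = "\<lambda>(i, j). i * n + j"])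
    fix x :: "nat \<times> nat"
    assume "x \<in> {..<n} \<times> {..<n}"
    then obtain i j where x: "x = (i, j)" "i < n" "j < n"
      by auto
    have "i * n + j < Suc i * n"
      using x by simp
    also have "\<dots> \<le> n * n"
      using x by (intro mult_right_mono) auto
    finally show "(case x of (i, j) \<Rightarrow> i * n + j) \<in> {..<n * n}"
      using x by simp
    show "((case x of (i, j) \<Rightarrow> i * n + j) div n, (case x of (i, j) \<Rightarrow> i * n + j) mod n) = x"
      using x by simp
  qed (auto simp: less_mult_imp_div_less intro!: mod_less_divisor gr0I)
  then show ?thesis
    by (simp add: sum.cartesian_product)
qed

text \<open>The tensor product of an eigenvector of \<open>A\<close> and one of \<open>B\<close> is
  an eigenvector for the difference.\<close>

lemma eigenvalue_kronecker_diff: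
  fixes A B :: "'a::field mat"
  assumes A: "A \<in> carrier_mat n n" and B: "B \<in> carrier_mat n n"
    and "eigenvalue A a" and "eigenvalue B b"
  shows "eigenvalue (kronecker_diff n A B) (a - b)"
proof -
  obtain u where u: "u \<in> carrier_vec n" "u \<noteq> 0\<^sub>v n" "A *\<^sub>v u = a \<cdot>\<^sub>v u"
    using assms by (auto simp: eigenvalue_def eigenvector_def)
  obtain v where v: "v \<in> carrier_vec n" "v \<noteq> 0\<^sub>v n" "B *\<^sub>v v = b \<cdot>\<^sub>v v"
    using assms by (auto simp: eigenvalue_def eigenvector_def)
  define w where "w = vec (n * n) (\<lambda>p. u $ (p div n) * v $ (p mod n))"
  have Au: "(\<Sum>k<n. A $$ (i, k) * u $ k) = a * u $ i" if "i < n" for i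
    using arg_cong[OF u(3), of "\<lambda>z. z $ i"] that A u(1)
    by (simp add: scalar_prod_def atLeast0LessThan)
  have Bv: "(\<Sum>k<n. B $$ (i, k) * v $ k) = b * v $ i" if "i < n" for i
    using arg_cong[OF v(3), of "\<lambda>z. z $ i"] that B v(1)
    by (simp add: scalar_prod_def atLeast0LessThan)
  have "w \<noteq> 0\<^sub>v (n * n)"
  proof
    assume w0: "w = 0\<^sub>v (n * n)"
    obtain i where i: "i < n" "u $ i \<noteq> 0"
      using u by (metis carrier_vecD eq_vecI index_zero_vec)
    obtain j where j: "j < n" "v $ j \<noteq> 0"
      using v by (metis carrier_vecD eq_vecI index_zero_vec)
    have "i * n + j < Suc i * n"
      using j by simp
    also have "\<dots> \<le> n * n"
      using i by (intro mult_right_mono) auto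
    finally have lt: "i * n + j < n * n" .
    have "w $ (i * n + j) = 0"
      using w0 lt by simp
    with i j lt show False
      by (simp add: w_def)
  qed
  moreover have "kronecker_diff n A B *\<^sub>v w = (a - b) \<cdot>\<^sub>v w"
  proof (rule eq_vecI)
    fix p
    assume "p < dim_vec ((a - b) \<cdot>\<^sub>v w)"
    then have p: "p < n * n"
      by (simp add: w_def)
    then have n: "n > 0"
      by (cases n) auto
    let ?i = "p div n" and ?j = "p mod n"
    have ij: "?i < n" "?j < n"
      using p n by (auto simp: less_mult_imp_div_less)
    have "(kronecker_diff n A B *\<^sub>v w) $ p = (\<Sum>q<n * n.
        ((if ?j = q mod n then A $$ (?i, q div n) else 0) -
         (if ?i = q div n then B $$ (?j, q mod n) else 0)) * (u $ (q div n) * v $ (q mod n)))"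
      using p by (simp add: kronecker_diff_def w_def scalar_prod_def atLeast0LessThan)
    also have "\<dots> = (\<Sum>k<n. \<Sum>l<n. ((if ?j = l then A $$ (?i, k) else 0) -
         (if ?i = k then B $$ (?j, l) else 0)) * (u $ k * v $ l))"
      by (rule sum_div_mod)
    \<comment> \<open>In each of the two double sums a Kronecker delta collapses one index, leaving
      a row of \<open>A\<close> applied to \<open>u\<close> or a row of \<open>B\<close> applied to
      \<open>v\<close>.\<close>
    also have "\<dots> = (\<Sum>k<n. \<Sum>l<n. if ?j = l then A $$ (?i, k) * u $ k * v $ l else 0) -
        (\<Sum>k<n. \<Sum>l<n. if ?i = k then B $$ (?j, l) * v $ l * u $ k else 0)"
      unfolding sum_subtractf[symmetric] by (intro sum.cong refl) (auto simp: algebra_simps)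
    also have "(\<Sum>k<n. \<Sum>l<n. if ?j = l then A $$ (?i, k) * u $ k * v $ l else 0) =
        (\<Sum>k<n. A $$ (?i, k) * u $ k) * v $ ?j"
      using ij by (simp add: sum_distrib_right)
    also have "(\<Sum>k<n. \<Sum>l<n. if ?i = k then B $$ (?j, l) * v $ l * u $ k else 0) =
        (\<Sum>l<n. B $$ (?j, l) * v $ l) * u $ ?i"
      by (subst sum.swap) (use ij in \<open>simp add: sum_distrib_right\<close>)
    finally show "(kronecker_diff n A B *\<^sub>v w) $ p = ((a - b) \<cdot>\<^sub>v w) $ p"
      unfolding Au[OF ij(1)] Bv[OF ij(2)] using p by (simp add: w_def algebra_simps)
  qed (simp add: kronecker_diff_def w_def)
  ultimately have "eigenvector (kronecker_diff n A B) w (a - b)"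
    by (simp add: eigenvector_def kronecker_diff_def w_def)
  then show ?thesis
    by (auto simp: eigenvalue_def)
qed

lemma poly_map_poly_eval:
  fixes P :: "'a::comm_ring_1 poly poly"
  shows "poly (map_poly (\<lambda>p. poly p t) P) y = poly (poly P [:y:]) t"
  by (induction P) (auto simp: map_poly_pCons)

text \<open>The witness is the characteristic polynomial of \<open>kronecker_diff n A B\<close> over
  the ring of polynomials in \<open>t\<close>. It is monic, hence nonzero, and evaluation at
  \<open>t\<close> is a ring homomorphism, so it commutes with forming the characteristic
  polynomial. One \<open>P\<close> thus serves every \<open>t\<close>.\<close>

lemma eigenvalue_diff_algebraic:
  fixes A B :: "real poly mat"
  assumes A: "A \<in> carrier_mat n n" and B: "B \<in> carrier_mat n n"
  shows "\<exists>P :: real poly poly. P \<noteq> 0 \<and>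
    (\<forall>t a b. eigenvalue (map_mat (\<lambda>p. poly p t) A) a \<longrightarrow>
      eigenvalue (map_mat (\<lambda>p. poly p t) B) b \<longrightarrow> poly (poly P [:a - b:]) t = 0)"
proof (intro exI conjI allI impI)
  let ?K = "kronecker_diff n A B"
  have K: "?K \<in> carrier_mat (n * n) (n * n)"
    by (simp add: kronecker_diff_def)
  show "char_poly ?K \<noteq> 0"
    using degree_monic_char_poly[OF K] by auto
  fix t a b
  assume a: "eigenvalue (map_mat (\<lambda>p. poly p t) A) a"
    and b: "eigenvalue (map_mat (\<lambda>p. poly p t) B) b"
  have mapK: "map_mat (\<lambda>p. poly p t) ?K =
      kronecker_diff n (map_mat (\<lambda>p. poly p t) A) (map_mat (\<lambda>p. poly p t) B)"
  proof (rule eq_matI)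
    fix p q
    assume "p < dim_row (kronecker_diff n (map_mat (\<lambda>p. poly p t) A) (map_mat (\<lambda>p. poly p t) B))"
      and "q < dim_col (kronecker_diff n (map_mat (\<lambda>p. poly p t) A) (map_mat (\<lambda>p. poly p t) B))"
    then have pq: "p < n * n" "q < n * n"
      by (auto simp: kronecker_diff_def)
    then have "n > 0"
      by (cases n) auto
    then have "p div n < n" "q div n < n" "p mod n < n" "q mod n < n"
      using pq by (auto simp: less_mult_imp_div_less)
    then show "map_mat (\<lambda>p. poly p t) ?K $$ (p, q) =
        kronecker_diff n (map_mat (\<lambda>p. poly p t) A) (map_mat (\<lambda>p. poly p t) B) $$ (p, q)"
      using pq A B by (simp add: kronecker_diff_def)
  qed (simp_all add: kronecker_diff_def)
  have "eigenvalue (map_mat (\<lambda>p. poly p t) ?K) (a - b)"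
    unfolding mapK using A B a b by (intro eigenvalue_kronecker_diff) auto
  then have "poly (char_poly (map_mat (\<lambda>p. poly p t) ?K)) (a - b) = 0"
    using eigenvalue_root_char_poly[of "map_mat (\<lambda>p. poly p t) ?K" "n * n"] K by auto
  then show "poly (poly (char_poly ?K) [:a - b:]) t = 0"
    by (simp add: poly_hom.char_poly_hom[OF K] poly_map_poly_eval)
qed

section \<open>Rayleigh principle for real symmetric matrices\<close>

text \<open>Vectors are functions on all of \<open>nat\<close>, so the sphere condition leaves the
  coordinates from \<open>n\<close> on free. Intersecting with the cube of functions into
  \<open>{- 1..1}\<close>, compact by Tychonoff, restores compactness.\<close>

lemma quadratic_form_attains_min_on_sphere:
  fixes a :: "nat \<Rightarrow> nat \<Rightarrow> real"
  assumes "n > 0"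
  shows "\<exists>x. (\<Sum>i<n. (x i)\<^sup>2) = 1 \<and> (\<forall>y. (\<Sum>i<n. (y i)\<^sup>2) = 1 \<longrightarrow>
      (\<Sum>i<n. \<Sum>j<n. a i j * x i * x j) \<le> (\<Sum>i<n. \<Sum>j<n. a i j * y i * y j))"
proof -
  let ?q = "\<lambda>x :: nat \<Rightarrow> real. \<Sum>i<n. \<Sum>j<n. a i j * x i * x j"
  define C where "C = (UNIV :: nat set) \<rightarrow>\<^sub>E {- 1..1 :: real}"
  define K where "K = C \<inter> {x. (\<Sum>i<n. (x i)\<^sup>2) = 1}"
  have "compactin (product_topology (\<lambda>i. euclidean) UNIV) C"
    unfolding C_def compactin_PiE by simp
  then have "compact C"
    by (simp add: euclidean_product_topology)
  moreover have "closed {x :: nat \<Rightarrow> real. (\<Sum>i<n. (x i)\<^sup>2) = 1}"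
    by (intro closed_Collect_eq continuous_intros continuous_on_product_coordinates)
  ultimately have "compact K"
    unfolding K_def by (rule compact_Int_closed)
  moreover have "(\<lambda>i. if i = 0 then 1 else 0) \<in> K"
    using assms by (auto simp: K_def C_def if_distrib[of "\<lambda>z. z ^ 2"] cong: if_cong)
  then have "K \<noteq> {}"
    by auto
  moreover have "continuous_on K ?q"
    by (intro continuous_intros continuous_on_subset[OF continuous_on_product_coordinates]) auto
  ultimately obtain x where x: "x \<in> K" and min: "\<forall>y\<in>K. ?q x \<le> ?q y"
    using continuous_attains_inf by blast
  show ?thesis
  proof (intro exI[of _ x] conjI allI impI)
    show "(\<Sum>i<n. (x i)\<^sup>2) = 1"
      using x by (simp add: K_def)
    fix y :: "nat \<Rightarrow> real"
    assume y: "(\<Sum>i<n. (y i)\<^sup>2) = 1"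
    \<comment> \<open>Truncation brings \<open>y\<close> into the cube and changes neither the norm
      nor the form.\<close>
    define z where "z = (\<lambda>i. if i < n then y i else 0)"
    have "(y i)\<^sup>2 \<le> 1" if "i < n" for i
      unfolding y[symmetric] using that by (intro member_le_sum) auto
    then have "\<bar>z i\<bar> \<le> 1" for i
      by (auto simp: z_def abs_square_le_1)
    then have "z \<in> C"
      by (auto simp: C_def abs_le_iff minus_le_iff)
    moreover have "(\<Sum>i<n. (z i)\<^sup>2) = 1"
      using y by (simp add: z_def)
    ultimately have "?q x \<le> ?q z"
      using min by (simp add: K_def)
    then show "?q x \<le> ?q y"
      by (simp add: z_def)
  qed
qed


text \<open>Take \<open>m\<close> to be the minimum of the form on the unit sphere. Homogeneity
  extends the bound to all \<open>y\<close>, and a minimizer must have zero residual, since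
  otherwise moving along the residual would violate the bound.\<close>

lemma symmetric_form_least_eigenvalue:
  fixes a :: "nat \<Rightarrow> nat \<Rightarrow> real"
  assumes "n > 0" and sym: "\<And>i j. i < n \<Longrightarrow> j < n \<Longrightarrow> a i j = a j i"
  shows "\<exists>x m. (\<Sum>i<n. (x i)\<^sup>2) = 1 \<and> (\<forall>i<n. (\<Sum>j<n. a i j * x j) = m * x i) \<and>
    (\<forall>y. m * (\<Sum>i<n. (y i)\<^sup>2) \<le> (\<Sum>i<n. \<Sum>j<n. a i j * y i * y j))"
proof -
  let ?q = "\<lambda>x :: nat \<Rightarrow> real. \<Sum>i<n. \<Sum>j<n. a i j * x i * x j"
  obtain x where x: "(\<Sum>i<n. (x i)\<^sup>2) = 1"
    and min: "\<forall>y. (\<Sum>i<n. (y i)\<^sup>2) = 1 \<longrightarrow> ?q x \<le> ?q y"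
    using quadratic_form_attains_min_on_sphere[OF \<open>n > 0\<close>, of a] by blast
  define m where "m = ?q x"
  have le: "m * (\<Sum>i<n. (y i)\<^sup>2) \<le> ?q y" for y
  proof (cases "(\<Sum>i<n. (y i)\<^sup>2) = 0")
    case True
    then have "\<forall>i<n. y i = 0"
      by (simp add: sum_nonneg_eq_0_iff)
    then show ?thesis
      by simp
  next
    case False
    let ?N = "\<Sum>i<n. (y i)\<^sup>2"
    have N: "?N > 0"
      using False by (simp add: order_less_le sum_nonneg)
    define z where "z = (\<lambda>i. y i / sqrt ?N)"
    have "(\<Sum>i<n. (z i)\<^sup>2) = (\<Sum>i<n. (y i)\<^sup>2 / ?N)"
      using N by (intro sum.cong) (auto simp: z_def power_divide)
    also have "\<dots> = 1"
      using N by (simp add: sum_divide_distrib[symmetric])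
    finally have "m \<le> ?q z"
      unfolding m_def using min by blast
    also have "?q z = (\<Sum>i<n. \<Sum>j<n. a i j * y i * y j / ?N)"
    proof (intro sum.cong refl)
      fix i j
      have "a i j * z i * z j = a i j * y i * y j / (sqrt ?N * sqrt ?N)"
        by (simp add: z_def)
      then show "a i j * z i * z j = a i j * y i * y j / ?N"
        using N by simp
    qed
    also have "\<dots> = ?q y / ?N"
      by (simp add: sum_divide_distrib)
    finally show ?thesis
      using N by (simp add: pos_le_divide_eq)
  qed
  define r where "r = (\<lambda>i. (\<Sum>j<n. a i j * x j) - m * x i)"
  let ?s = "\<Sum>i<n. (r i)\<^sup>2"
  define c where "c = ?q r - m * ?s"
  have "c \<ge> 0"
    using le[of r] by (simp add: c_def)
  \<comment> \<open>Along the line through \<open>x\<close> in the direction of the residual \<open>r\<close>, the nonnegative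
    form \<open>q - m\<parallel>\<cdot>\<parallel>\<^sup>2\<close> is \<open>2 s t + c t\<^sup>2\<close>, which forces \<open>s = \<parallel>r\<parallel>\<^sup>2 = 0\<close>.\<close>
  have line: "0 \<le> 2 * t * ?s + t\<^sup>2 * c" for t
  proof -
    \<comment> \<open>This is the inner product of \<open>r\<close> with the residual, which is
      \<open>r\<close> itself.\<close>
    have cross: "(\<Sum>i<n. \<Sum>j<n. a i j * r i * x j) - m * (\<Sum>i<n. r i * x i) = ?s"
      unfolding sum_distrib_left sum_subtractf[symmetric]
    proof (intro sum.cong refl)
      fix i
      have "(\<Sum>j<n. a i j * r i * x j) = r i * (\<Sum>j<n. a i j * x j)"
        by (simp add: sum_distrib_left mult_ac)
      then show "(\<Sum>j<n. a i j * r i * x j) - m * (r i * x i) = (r i)\<^sup>2"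
        by (simp add: r_def power2_eq_square right_diff_distrib mult_ac)
    qed
    have swap: "(\<Sum>i<n. \<Sum>j<n. a i j * x i * r j) = (\<Sum>i<n. \<Sum>j<n. a i j * r i * x j)"
      by (subst sum.swap, intro sum.cong refl) (simp add: sym)
    have q: "?q (\<lambda>i. x i + t * r i) = ?q x + t * (\<Sum>i<n. \<Sum>j<n. a i j * x i * r j)
        + t * (\<Sum>i<n. \<Sum>j<n. a i j * r i * x j) + t\<^sup>2 * ?q r"
      unfolding sum_distrib_left sum.distrib[symmetric]
      by (intro sum.cong refl) (simp add: power2_eq_square algebra_simps)
    have norm: "(\<Sum>i<n. (x i + t * r i)\<^sup>2) = (\<Sum>i<n. (x i)\<^sup>2) + 2 * t * (\<Sum>i<n. r i * x i) + t\<^sup>2 * ?s"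
      unfolding sum_distrib_left sum.distrib[symmetric]
      by (intro sum.cong refl) (simp add: power2_eq_square algebra_simps)
    have "0 \<le> ?q (\<lambda>i. x i + t * r i) - m * (\<Sum>i<n. (x i + t * r i)\<^sup>2)"
      using le[of "\<lambda>i. x i + t * r i"] by simp
    also have "\<dots> = 2 * t * ((\<Sum>i<n. \<Sum>j<n. a i j * r i * x j) - m * (\<Sum>i<n. r i * x i)) + t\<^sup>2 * c"
      unfolding q norm swap x c_def m_def[symmetric] by (simp add: algebra_simps)
    finally show ?thesis
      unfolding cross .
  qed
  have "?s = 0"
  proof (rule ccontr)
    assume "?s \<noteq> 0"
    then have s: "?s > 0"
      by (simp add: order_less_le sum_nonneg)
    \<comment> \<open>The denominator is \<open>c + 1\<close> because \<open>c\<close> may vanish.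
      With this \<open>t\<close> and \<open>?s\<close> as the squared norm of \<open>r\<close>, the
      expression in \<open>line\<close> becomes \<open>t * (?s - t)\<close>, which is
      negative.\<close>
    define t where "t = - ?s / (c + 1)"
    have "t < 0" and tc: "t * (c + 1) = - ?s"
      using s \<open>c \<ge> 0\<close> by (simp_all add: t_def)
    have "2 * t * ?s + t\<^sup>2 * c = t * (2 * ?s + t * c)"
      by (simp add: power2_eq_square algebra_simps)
    also have "t * c = - ?s - t"
      using tc by (simp add: algebra_simps)
    also have "t * (2 * ?s + (- ?s - t)) < 0"
      using \<open>t < 0\<close> s by (intro mult_neg_pos) auto
    finally show False
      using line[of t] by simp
  qed
  then have "r i = 0" if "i < n" for i
    using that by (simp add: sum_nonneg_eq_0_iff)
  then have "(\<Sum>j<n. a i j * x j) = m * x i" if "i < n" for i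
    using that by (simp add: r_def)
  with x le show ?thesis
    by blast
qed

text \<open>The minimum \<open>m\<close> of the Rayleigh quotient is an eigenvalue. Hence the finite
  spectrum is nonempty, \<open>Min\<close> returns one of its elements, and
  \<open>lambda_min A\<close> is at most \<open>m\<close>, so it inherits the lower bound on the
  form.\<close>

lemma lambda_min_symmetric:
  fixes A :: "real mat"
  assumes A: "A \<in> carrier_mat n n" and "n > 0"
    and sym: "\<And>i j. i < n \<Longrightarrow> j < n \<Longrightarrow> A $$ (i, j) = A $$ (j, i)"
  shows eigenvalue_lambda_min: "eigenvalue A (lambda_min A)"
    and lambda_min_le_rayleigh:
      "v \<in> carrier_vec n \<Longrightarrow> lambda_min A * (v \<bullet> v) \<le> v \<bullet> (A *\<^sub>v v)"
    and lambda_min_le_eigenvalue: "eigenvalue A e \<Longrightarrow> lambda_min A \<le> e"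
proof -
  have fin: "finite (spectrum A)"
    by (rule card_finite_spectrum[OF A])
  then show le: "eigenvalue A e \<Longrightarrow> lambda_min A \<le> e" for e
    by (simp add: lambda_min_def spectrum_def)
  obtain x m where x: "(\<Sum>i<n. (x i)\<^sup>2) = 1"
    and eig: "\<forall>i<n. (\<Sum>j<n. A $$ (i, j) * x j) = m * x i"
    and min: "\<forall>y. m * (\<Sum>i<n. (y i)\<^sup>2) \<le> (\<Sum>i<n. \<Sum>j<n. A $$ (i, j) * y i * y j)"
    using symmetric_form_least_eigenvalue[of n "\<lambda>i j. A $$ (i, j)", OF \<open>n > 0\<close> sym] by blast
  have "A *\<^sub>v vec n x = m \<cdot>\<^sub>v vec n x"
    using A eig by (intro eq_vecI) (auto simp: scalar_prod_def atLeast0LessThan)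
  moreover have "vec n x \<noteq> 0\<^sub>v n"
  proof
    assume "vec n x = 0\<^sub>v n"
    then have "x i = 0" if "i < n" for i
      using that by (metis index_vec index_zero_vec(1))
    with x show False
      by simp
  qed
  ultimately have m: "eigenvalue A m"
    using A unfolding eigenvalue_def eigenvector_def by (intro exI[of _ "vec n x"]) auto
  then have "spectrum A \<noteq> {}"
    by (auto simp: spectrum_def)
  with fin have "lambda_min A \<in> spectrum A"
    unfolding lambda_min_def by (rule Min_in)
  then show "eigenvalue A (lambda_min A)"
    by (simp add: spectrum_def)
  assume v: "v \<in> carrier_vec n"
  have vv: "v \<bullet> v = (\<Sum>i<n. (v $ i)\<^sup>2)"
    using v by (simp add: scalar_prod_def atLeast0LessThan power2_eq_square)
  have "lambda_min A * (v \<bullet> v) \<le> m * (v \<bullet> v)"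
    unfolding vv by (intro mult_right_mono le m sum_nonneg) auto
  also have "\<dots> \<le> (\<Sum>i<n. \<Sum>j<n. A $$ (i, j) * v $ i * v $ j)"
    unfolding vv using min by blast
  also have "\<dots> = v \<bullet> (A *\<^sub>v v)"
    using A v by (simp add: scalar_prod_def atLeast0LessThan sum_distrib_left mult.assoc mult.left_commute)
  finally show "lambda_min A * (v \<bullet> v) \<le> v \<bullet> (A *\<^sub>v v)" .
qed

text \<open>Test the Rayleigh bound for \<open>B\<close> on an eigenvector of \<open>A\<close> for
  its least eigenvalue.\<close>

lemma lambda_min_le_add:
  fixes A B :: "real mat"
  assumes A: "A \<in> carrier_mat n n" and B: "B \<in> carrier_mat n n" and "n > 0"
    and symA: "\<And>i j. i < n \<Longrightarrow> j < n \<Longrightarrow> A $$ (i, j) = A $$ (j, i)"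
    and symB: "\<And>i j. i < n \<Longrightarrow> j < n \<Longrightarrow> B $$ (i, j) = B $$ (j, i)"
    and close: "\<And>v. v \<in> carrier_vec n \<Longrightarrow> v \<bullet> (B *\<^sub>v v) \<le> v \<bullet> (A *\<^sub>v v) + d * (v \<bullet> v)"
  shows "lambda_min B \<le> lambda_min A + d"
proof -
  obtain u where u: "u \<in> carrier_vec n" "u \<noteq> 0\<^sub>v n" "A *\<^sub>v u = lambda_min A \<cdot>\<^sub>v u"
    using eigenvalue_lambda_min[OF A \<open>n > 0\<close> symA] A by (auto simp: eigenvalue_def eigenvector_def)
  obtain i where i: "i < n" "u $ i \<noteq> 0"
    using u by (metis carrier_vecD eq_vecI index_zero_vec)
  have "u \<bullet> u = (\<Sum>i<n. (u $ i)\<^sup>2)"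
    using u by (simp add: scalar_prod_def atLeast0LessThan power2_eq_square)
  also have "\<dots> > 0"
    using i by (intro sum_pos2[of _ i]) auto
  finally have pos: "u \<bullet> u > 0" .
  have "lambda_min B * (u \<bullet> u) \<le> u \<bullet> (B *\<^sub>v u)"
    by (rule lambda_min_le_rayleigh[OF B \<open>n > 0\<close> symB u(1)])
  also have "\<dots> \<le> u \<bullet> (A *\<^sub>v u) + d * (u \<bullet> u)"
    by (rule close[OF u(1)])
  also have "\<dots> = (lambda_min A + d) * (u \<bullet> u)"
    using u by (simp add: algebra_simps)
  finally show ?thesis
    using pos by simp
qed

text \<open>Both matrices have the same eigenvectors, and the eigenvalues correspond under the
  decreasing map sending \<open>x\<close> to \<open>1 - c * x\<close>, which turns the least into
  the greatest.\<close>

lemma lambda_max_one_minus_smult: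
  fixes A :: "real mat"
  assumes A: "A \<in> carrier_mat n n" and "n > 0"
    and sym: "\<And>i j. i < n \<Longrightarrow> j < n \<Longrightarrow> A $$ (i, j) = A $$ (j, i)"
    and "c > 0"
  shows "lambda_max (1\<^sub>m n - c \<cdot>\<^sub>m A) = 1 - c * lambda_min A"
proof -
  let ?Z = "1\<^sub>m n - c \<cdot>\<^sub>m A"
  have Z: "?Z \<in> carrier_mat n n"
    using A by (intro minus_carrier_mat smult_carrier_mat)
  have mult: "?Z *\<^sub>v v = v - c \<cdot>\<^sub>v (A *\<^sub>v v)" if "v \<in> carrier_vec n" for v
    using that A by (intro eq_vecI) (auto simp: minus_mult_distrib_mat_vec[of _ n n] scalar_prod_def sum_distrib_left mult.assoc)
  have iff: "?Z *\<^sub>v v = e \<cdot>\<^sub>v v \<longleftrightarrow> A *\<^sub>v v = ((1 - e) / c) \<cdot>\<^sub>v v" if v: "v \<in> carrier_vec n" for v e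
  proof -
    have "?Z *\<^sub>v v = e \<cdot>\<^sub>v v \<longleftrightarrow> (\<forall>i<n. v $ i - c * (A *\<^sub>v v) $ i = e * v $ i)"
      unfolding mult[OF v] using v A by (auto simp: vec_eq_iff)
    also have "\<dots> \<longleftrightarrow> (\<forall>i<n. (A *\<^sub>v v) $ i = (1 - e) / c * v $ i)"
      using \<open>c > 0\<close> by (auto simp: field_simps)
    also have "\<dots> \<longleftrightarrow> A *\<^sub>v v = ((1 - e) / c) \<cdot>\<^sub>v v"
      using v A by (auto simp: vec_eq_iff)
    finally show ?thesis .
  qed
  have eig: "eigenvalue ?Z e \<longleftrightarrow> eigenvalue A ((1 - e) / c)" for e
    unfolding eigenvalue_def eigenvector_def using A iff by auto
  show ?thesis
    unfolding lambda_max_def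
  proof (rule Max_eqI)
    show "finite (spectrum ?Z)"
      by (rule card_finite_spectrum[OF Z])
    show "1 - c * lambda_min A \<in> spectrum ?Z"
      using eigenvalue_lambda_min[OF A \<open>n > 0\<close> sym] \<open>c > 0\<close> by (simp add: spectrum_def eig)
    fix e
    assume "e \<in> spectrum ?Z"
    then have "lambda_min A \<le> (1 - e) / c"
      using lambda_min_le_eigenvalue[OF A \<open>n > 0\<close> sym] by (simp add: spectrum_def eig)
    then show "e \<le> 1 - c * lambda_min A"
      using \<open>c > 0\<close> by (simp add: field_simps)
  qed
qed


section \<open>Least eigenvalues of linear matrix pencils\<close>

lemma scalar_prod_pencil:
  fixes L P :: "real mat"
  assumes "L \<in> carrier_mat n n" and "P \<in> carrier_mat n n" and "v \<in> carrier_vec n"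
  shows "v \<bullet> ((L - t \<cdot>\<^sub>m P) *\<^sub>v v) = v \<bullet> (L *\<^sub>v v) - t * (v \<bullet> (P *\<^sub>v v))"
  using assms
  by (auto simp: scalar_prod_def left_diff_distrib right_diff_distrib sum_subtractf
      sum_distrib_left mult_ac)

text \<open>The bound on the form of \<open>P\<close> makes the function 1-Lipschitz:
  \<open>lambda_min_le_add\<close> applies with \<open>d\<close> equal to the distance of the two
  parameters, in both directions.\<close>

lemma continuous_on_lambda_min_pencil:
  fixes L P :: "real mat"
  assumes L: "L \<in> carrier_mat n n" and P: "P \<in> carrier_mat n n" and "n > 0"
    and symL: "\<And>i j. i < n \<Longrightarrow> j < n \<Longrightarrow> L $$ (i, j) = L $$ (j, i)"
    and symP: "\<And>i j. i < n \<Longrightarrow> j < n \<Longrightarrow> P $$ (i, j) = P $$ (j, i)"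
    and bound: "\<And>v. v \<in> carrier_vec n \<Longrightarrow> \<bar>v \<bullet> (P *\<^sub>v v)\<bar> \<le> v \<bullet> v"
  shows "continuous_on X (\<lambda>t. lambda_min (L - t \<cdot>\<^sub>m P))"
proof -
  have carrier: "L - t \<cdot>\<^sub>m P \<in> carrier_mat n n" for t
    using P by (intro minus_carrier_mat smult_carrier_mat)
  have sym: "(L - t \<cdot>\<^sub>m P) $$ (i, j) = (L - t \<cdot>\<^sub>m P) $$ (j, i)" if "i < n" "j < n" for t i j
    using that L P symL[OF that] symP[OF that] by simp
  have le: "lambda_min (L - t \<cdot>\<^sub>m P) \<le> lambda_min (L - s \<cdot>\<^sub>m P) + \<bar>s - t\<bar>" for s t
  proof (rule lambda_min_le_add[OF carrier carrier \<open>n > 0\<close> sym sym])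
    fix v :: "real vec"
    assume v: "v \<in> carrier_vec n"
    have "(s - t) * (v \<bullet> (P *\<^sub>v v)) \<le> \<bar>s - t\<bar> * \<bar>v \<bullet> (P *\<^sub>v v)\<bar>"
      by (metis abs_ge_self abs_mult)
    also have "\<dots> \<le> \<bar>s - t\<bar> * (v \<bullet> v)"
      using bound[OF v] by (intro mult_left_mono) auto
    finally show "v \<bullet> ((L - t \<cdot>\<^sub>m P) *\<^sub>v v) \<le> v \<bullet> ((L - s \<cdot>\<^sub>m P) *\<^sub>v v) + \<bar>s - t\<bar> * (v \<bullet> v)"
      unfolding scalar_prod_pencil[OF L P v] by (simp add: algebra_simps)
  qed
  have "dist (lambda_min (L - s \<cdot>\<^sub>m P)) (lambda_min (L - t \<cdot>\<^sub>m P)) \<le> dist s t" for s t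
    using le[of s t] le[of t s] by (auto simp: dist_real_def)
  then show ?thesis
    unfolding continuous_on_def
    by (intro ballI metric_tendsto_imp_tendsto[OF tendsto_ident_at]) auto
qed

text \<open>The difference of the two least eigenvalues is continuous and algebraic in the
  parameter, so its sign is constant near 0. The strict comparison is the form in which
  \<open>is_arg_max\<close> and \<open>is_arg_min\<close> use it.\<close>

lemma lambda_min_pencils_comparison_constant:
  fixes L P Q :: "real mat"
  assumes L: "L \<in> carrier_mat n n" and P: "P \<in> carrier_mat n n" and Q: "Q \<in> carrier_mat n n"
    and "n > 0"
    and symL: "\<And>i j. i < n \<Longrightarrow> j < n \<Longrightarrow> L $$ (i, j) = L $$ (j, i)"
    and symP: "\<And>i j. i < n \<Longrightarrow> j < n \<Longrightarrow> P $$ (i, j) = P $$ (j, i)"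
    and symQ: "\<And>i j. i < n \<Longrightarrow> j < n \<Longrightarrow> Q $$ (i, j) = Q $$ (j, i)"
    and boundP: "\<And>v. v \<in> carrier_vec n \<Longrightarrow> \<bar>v \<bullet> (P *\<^sub>v v)\<bar> \<le> v \<bullet> v"
    and boundQ: "\<And>v. v \<in> carrier_vec n \<Longrightarrow> \<bar>v \<bullet> (Q *\<^sub>v v)\<bar> \<le> v \<bullet> v"
  shows "\<exists>d>0. \<forall>s t. 0 < s \<longrightarrow> s < d \<longrightarrow> 0 < t \<longrightarrow> t < d \<longrightarrow>
    (lambda_min (L - s \<cdot>\<^sub>m P) < lambda_min (L - s \<cdot>\<^sub>m Q) \<longleftrightarrow>
     lambda_min (L - t \<cdot>\<^sub>m P) < lambda_min (L - t \<cdot>\<^sub>m Q))"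
proof -
  define g where "g t = lambda_min (L - t \<cdot>\<^sub>m P) - lambda_min (L - t \<cdot>\<^sub>m Q)" for t
  have cont: "continuous_on {0<..} g"
    unfolding g_def using assms by (intro continuous_on_diff continuous_on_lambda_min_pencil)
  \<comment> \<open>The pencil becomes a single matrix over polynomials in \<open>t\<close>, as
    \<open>eigenvalue_diff_algebraic\<close> expects.\<close>
  define pencil where
    "pencil R = mat n n (\<lambda>(i, j). [:L $$ (i, j), - R $$ (i, j):])" for R :: "real mat"
  have pencil: "pencil R \<in> carrier_mat n n" for R
    by (simp add: pencil_def)
  have eig: "eigenvalue (map_mat (\<lambda>p. poly p t) (pencil R)) (lambda_min (L - t \<cdot>\<^sub>m R))"
    if R: "R \<in> carrier_mat n n"
      and symR: "\<And>i j. i < n \<Longrightarrow> j < n \<Longrightarrow> R $$ (i, j) = R $$ (j, i)" for R t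
  proof -
    have carrier: "L - t \<cdot>\<^sub>m R \<in> carrier_mat n n"
      using R by (intro minus_carrier_mat smult_carrier_mat)
    have "map_mat (\<lambda>p. poly p t) (pencil R) = L - t \<cdot>\<^sub>m R"
      using L R by (intro eq_matI) (auto simp: pencil_def)
    moreover have "eigenvalue (L - t \<cdot>\<^sub>m R) (lambda_min (L - t \<cdot>\<^sub>m R))"
    proof (rule eigenvalue_lambda_min[OF carrier \<open>n > 0\<close>])
      fix i j
      assume ij: "i < n" "j < n"
      show "(L - t \<cdot>\<^sub>m R) $$ (i, j) = (L - t \<cdot>\<^sub>m R) $$ (j, i)"
        using ij L R symL[OF ij] symR[OF ij] by simp
    qed
    ultimately show ?thesis
      by simp
  qed
  obtain F where "F \<noteq> 0"
    and F: "\<forall>t a b. eigenvalue (map_mat (\<lambda>p. poly p t) (pencil P)) a \<longrightarrow>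
      eigenvalue (map_mat (\<lambda>p. poly p t) (pencil Q)) b \<longrightarrow> poly (poly F [:a - b:]) t = 0"
    using eigenvalue_diff_algebraic[OF pencil pencil, of P Q] by blast
  have "poly (poly F [:g t:]) t = 0" for t
    unfolding g_def by (rule F[rule_format, OF eig[OF P symP] eig[OF Q symQ]])
  then obtain d where "d > 0"
    and d: "\<forall>s t. 0 < s \<longrightarrow> s < d \<longrightarrow> 0 < t \<longrightarrow> t < d \<longrightarrow> sgn (g s) = sgn (g t)"
    using algebraic_sgn_eventually_constant[OF cont \<open>F \<noteq> 0\<close>] by blast
  have "g s < 0 \<longleftrightarrow> g t < 0" if "0 < s" "s < d" "0 < t" "t < d" for s t
    using d[rule_format, OF that] by (metis sgn_less)
  then have "lambda_min (L - s \<cdot>\<^sub>m P) < lambda_min (L - s \<cdot>\<^sub>m Q) \<longleftrightarrow>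
      lambda_min (L - t \<cdot>\<^sub>m P) < lambda_min (L - t \<cdot>\<^sub>m Q)"
    if "0 < s" "s < d" "0 < t" "t < d" for s t
    using that unfolding g_def diff_less_0_iff_less by blast
  with \<open>d > 0\<close> show ?thesis
    by blast
qed

section \<open>The perturbed Laplacian and the comparison of optimizers\<close>

lemma sum_unit_outer_index:
  assumes "S \<subseteq> {..<n}" and "i < n" and "j < n"
  shows "sum_unit_outer n S $$ (i, j) = (if i = j \<and> i \<in> S then 1 else 0)"
proof -
  have "finite S"
    using assms(1) finite_subset by blast
  have "(\<Sum>k\<in>S. unit_vec n k $ i * unit_vec n k $ j) =
      (\<Sum>k\<in>S. if k = i then if i = j then 1 else 0 else (0 :: real))"
    using assms by (intro sum.cong) (auto simp: unit_vec_def)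
  then show ?thesis
    using assms \<open>finite S\<close> by (simp add: sum_unit_outer_def)
qed

text \<open>The matrix is the coordinate projection onto \<open>S\<close>, so its form sums the
  squares of the entries of \<open>v\<close> indexed by \<open>S\<close>.\<close>

lemma sum_unit_outer_form_bound:
  assumes S: "S \<subseteq> {..<n}" and v: "v \<in> carrier_vec n"
  shows "\<bar>v \<bullet> (sum_unit_outer n S *\<^sub>v v)\<bar> \<le> v \<bullet> v"
proof -
  have "(sum_unit_outer n S *\<^sub>v v) $ i = (if i \<in> S then v $ i else 0)" if "i < n" for i
  proof -
    have "(sum_unit_outer n S *\<^sub>v v) $ i = (\<Sum>j<n. sum_unit_outer n S $$ (i, j) * v $ j)"
      using that v by (simp add: scalar_prod_def atLeast0LessThan sum_unit_outer_def)
    also have "\<dots> = (\<Sum>j<n. if i = j then if i \<in> S then v $ j else 0 else 0)"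
      using that S by (intro sum.cong) (auto simp: sum_unit_outer_index)
    finally show ?thesis
      using that by simp
  qed
  then have "v \<bullet> (sum_unit_outer n S *\<^sub>v v) = (\<Sum>i<n. if i \<in> S then (v $ i)\<^sup>2 else 0)"
    by (auto simp: scalar_prod_def atLeast0LessThan sum_unit_outer_def power2_eq_square
        intro!: sum.cong)
  moreover have "0 \<le> (\<Sum>i<n. if i \<in> S then (v $ i)\<^sup>2 else 0)"
    by (intro sum_nonneg) auto
  moreover have "(\<Sum>i<n. if i \<in> S then (v $ i)\<^sup>2 else 0) \<le> (\<Sum>i<n. (v $ i)\<^sup>2)"
    by (intro sum_mono) auto
  moreover have "v \<bullet> v = (\<Sum>i<n. (v $ i)\<^sup>2)"
    using v by (simp add: scalar_prod_def atLeast0LessThan power2_eq_square)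
  ultimately show ?thesis
    by simp
qed

lemma laplacian_symmetric:
  assumes "pair_graph G" and "i < n" and "j < n"
  shows "laplacian n G $$ (i, j) = laplacian n G $$ (j, i)"
proof -
  interpret pair_graph G
    by fact
  have "(i, j) \<in> parcs G \<longleftrightarrow> (j, i) \<in> parcs G"
    using arcs_symmetric by blast
  then show ?thesis
    using assms by (simp add: laplacian_def degree_mat_def adjacency_mat_def)
qed

lemma perturbed_stochastic_mat_eq:
  assumes "\<tau> \<noteq> 0"
  shows "perturbed_stochastic_mat n G \<tau> \<epsilon> S = 1\<^sub>m n - \<tau> \<cdot>\<^sub>m perturbed_laplacian n G (\<epsilon> / \<tau>) S"
  using assms
  by (intro eq_matI) (auto simp: perturbed_stochastic_mat_def perturbed_laplacian_def
      stochastic_mat_def laplacian_def degree_mat_def adjacency_mat_def sum_unit_outer_def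
      right_diff_distrib)

theorem theorem4:
  fixes n k :: nat and G :: "nat pair_pre_digraph" and \<tau> :: real
  assumes "pair_graph G" and "pverts G = {..<n}"
    and "0 < \<tau>" and "max_degree G = 0 \<or> \<tau> < 1 / real (max_degree G)"
    and "k < n"
  shows "\<exists>\<epsilon>\<^sub>0>0. \<forall>\<epsilon>::real. 0 < \<epsilon> \<and> \<epsilon> < \<epsilon>\<^sub>0 \<longrightarrow>
    {S. is_arg_max (\<lambda>S. lambda_min (perturbed_laplacian n G \<epsilon> S))
          (\<lambda>S. S \<subseteq> {..<n} \<and> card S = k) S}
    = {S. is_arg_min (\<lambda>S. lambda_max (perturbed_stochastic_mat n G \<tau> \<epsilon> S))
          (\<lambda>S. S \<subseteq> {..<n} \<and> card S = k) S}"
proof -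
  let ?f = "\<lambda>\<epsilon> S. lambda_min (perturbed_laplacian n G \<epsilon> S)"
  have n: "n > 0"
    using assms by simp
  have L: "laplacian n G \<in> carrier_mat n n"
    by (simp add: laplacian_def degree_mat_def adjacency_mat_def minus_carrier_mat)
  have P: "sum_unit_outer n S \<in> carrier_mat n n" for S
    by (simp add: sum_unit_outer_def)
  have symL: "laplacian n G $$ (i, j) = laplacian n G $$ (j, i)" if "i < n" "j < n" for i j
    using laplacian_symmetric[OF \<open>pair_graph G\<close> that] .
  have symP: "sum_unit_outer n S $$ (i, j) = sum_unit_outer n S $$ (j, i)"
    if "i < n" "j < n" for S i j
    using that by (simp add: sum_unit_outer_def mult.commute)
  \<comment> \<open>There are finitely many pairs of node sets, so the least of their thresholds is
    positive and works for all pairs at once.\<close>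
  define D where "D = Pow {..<n} \<times> Pow {..<n}"
  have "\<forall>p\<in>D. \<exists>d>0. \<forall>s t. 0 < s \<longrightarrow> s < d \<longrightarrow> 0 < t \<longrightarrow> t < d \<longrightarrow>
      (?f s (fst p) < ?f s (snd p) \<longleftrightarrow> ?f t (fst p) < ?f t (snd p))"
    unfolding perturbed_laplacian_def D_def
    by (intro ballI lambda_min_pencils_comparison_constant[OF L P P n symL symP symP]
        sum_unit_outer_form_bound) auto
  then obtain d where dpos: "\<forall>p\<in>D. d p > 0"
    and d: "\<forall>p\<in>D. \<forall>s t. 0 < s \<longrightarrow> s < d p \<longrightarrow> 0 < t \<longrightarrow> t < d p \<longrightarrow>
      (?f s (fst p) < ?f s (snd p) \<longleftrightarrow> ?f t (fst p) < ?f t (snd p))"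
    by metis
  define e where "e = Min (d ` D)"
  have D: "finite (d ` D)" "d ` D \<noteq> {}"
    by (auto simp: D_def)
  have "e > 0"
    unfolding e_def using D dpos by simp
  have comparison: "?f s S < ?f s T \<longleftrightarrow> ?f t S < ?f t T"
    if "0 < s" "s < e" "0 < t" "t < e" "S \<subseteq> {..<n}" "T \<subseteq> {..<n}" for s t S T
  proof -
    have p: "(S, T) \<in> D"
      using that by (simp add: D_def)
    then have "e \<le> d (S, T)"
      unfolding e_def using D by (intro Min_le) auto
    then show ?thesis
      using bspec[OF d p, rule_format, of s t] that by simp
  qed
  have lambda_max: "lambda_max (perturbed_stochastic_mat n G \<tau> \<epsilon> S) = 1 - \<tau> * ?f (\<epsilon> / \<tau>) S" for \<epsilon> S
    unfolding perturbed_stochastic_mat_eq[OF less_imp_neq[OF \<open>0 < \<tau>\<close>, symmetric]]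
  proof (rule lambda_max_one_minus_smult[OF _ n _ \<open>0 < \<tau>\<close>])
    show "perturbed_laplacian n G (\<epsilon> / \<tau>) S \<in> carrier_mat n n"
      unfolding perturbed_laplacian_def using P by (intro minus_carrier_mat smult_carrier_mat)
    fix i j
    assume ij: "i < n" "j < n"
    show "perturbed_laplacian n G (\<epsilon> / \<tau>) S $$ (i, j) = perturbed_laplacian n G (\<epsilon> / \<tau>) S $$ (j, i)"
      unfolding perturbed_laplacian_def using ij L P[of S] symL[OF ij] symP[OF ij, of S] by simp
  qed
  have "is_arg_max (?f \<epsilon>) (\<lambda>S. S \<subseteq> {..<n} \<and> card S = k) S \<longleftrightarrow>
      is_arg_min (\<lambda>S. lambda_max (perturbed_stochastic_mat n G \<tau> \<epsilon> S))
        (\<lambda>S. S \<subseteq> {..<n} \<and> card S = k) S"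
    if "0 < \<epsilon>" "\<epsilon> < min e (\<tau> * e)" for \<epsilon> S
  proof -
    \<comment> \<open>The Laplacian is perturbed by \<open>\<epsilon>\<close> on one side and, after
      rescaling, by \<open>\<epsilon> / \<tau>\<close> on the other. The minimum of \<open>e\<close>
      and \<open>\<tau> * e\<close> keeps both parameters below \<open>e\<close>.\<close>
    have "0 < \<epsilon> / \<tau>" "\<epsilon> / \<tau> < e" "\<epsilon> < e"
      using that \<open>0 < \<tau>\<close> by (auto simp: field_simps)
    then have "?f \<epsilon> S < ?f \<epsilon> T \<longleftrightarrow> ?f (\<epsilon> / \<tau>) S < ?f (\<epsilon> / \<tau>) T"
      if "S \<subseteq> {..<n}" "T \<subseteq> {..<n}" for T
      using comparison that \<open>0 < \<epsilon>\<close> by blast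
    then show ?thesis
      unfolding is_arg_max_def is_arg_min_def lambda_max using \<open>0 < \<tau>\<close> by auto
  qed
  moreover have "min e (\<tau> * e) > 0"
    using \<open>e > 0\<close> \<open>0 < \<tau>\<close> by simp
  ultimately show ?thesis
    by blast
qed

end
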